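(* Let $\{e_i\}_{i\in I}$ be an orthonormal system in a Hilbert module $M$ over a unital $C^*$-algebra $A$. Consider the conditions: (c1) $M$ is the norm closure of the $A$-linear span of $\{e_i : i\in I\}$; (c2) for any $x\in M$ there are elements $a_i\in A$ ($i\in I$) such that $x=\sum_{i\in I}e_ia_i$, with convergence in norm; (c3) for any $x\in M$ the series $\sum_{i\in I}\bigl(2\langle x,e_i\rangle\langle e_i,x\rangle-\langle x,e_i\rangle\langle e_i,e_i\rangle\langle e_i,x\rangle\bigr)$ converges in norm to $\langle x,x\rangle$. Then the following conditions are equivalent, whichever of (c1), (c2), (c3) is chosen in (iii): (i) $\{e_i\}_{i\in I}$ is a Schauder basis for $M$; (ii) $\{e_i\}_{i\in I}$ is a standard Riesz basis of $M$; (iii) $\{e_i\}_{i\in I}$ satisfies any one of the conditions (c1), (c2), (c3).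
   Context: A Hilbert $A$-module is a right $A$-module $M$ (compatibly a complex vector space) with an $A$-valued inner product $\langle\cdot,\cdot\rangle$ that is linear in the second variable and satisfies $\langle x,ya\rangle=\langle x,y\rangle a$, $\langle x,y\rangle^*=\langle y,x\rangle$, $\langle x,x\rangle\ge 0$, and $\langle x,x\rangle=0$ only if $x=0$, and which is complete in the norm $\|x\|=\|\langle x,x\rangle\|^{1/2}$. A collection $\{e_i\}_{i\in I}$ of vectors of $M$, indexed by some set $I$, is called orthogonal if $\langle e_i,e_j\rangle=0$ whenever $i\neq j$, and orthonormal ($A$ being unital) if in addition $\langle e_i,e_i\rangle=1$ for all $i\in I$. Sums over a possibly infinite index set denote norm limits of the finite sums over its finite subsets, directed by inclusion. An orthogonal system $\{e_i\}_{i\in I}$ forms a Schauder basis for $M$ (over $A$) if for every $x\in M$ there are elements $a_i\in A$ with $x=\sum_{i\in I}e_ia_i$ and these coefficients $a_i$ are unique for every $x\in M$. A family $\{x_i\}_{i\in I}$ of vectors of $M$ is a frame if there are real constants $C,D>0$ such that $C\langle x,x\rangle\le\sum_{i\in I}\langle x,x_i\rangle\langle x_i,x\rangle\le D\langle x,x\rangle$ for every $x\in M$; the frame is called standard if $\langle x,x\rangle=\sum_{i\in I}\langle x,x_i\rangle\langle x_i,x\rangle$, with convergence in norm, for every $x\in M$. An orthogonal system $\{e_i\}_{i\in I}$ of $M$ is called a standard Riesz basis if it is a standard frame, satisfies (c1), and has the additional property that $A$-linear combinations $\sum_{j\in S}e_ja_j$ with coefficients $a_j\in A$ and $S\subset I$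 are equal to zero if and only if $e_ja_j=0$ for every $j\in S$. *)

theory Defs
  imports "HOL-Analysis.Analysis"
begin

class complex_vector = real_vector +
  fixes scaleC :: "complex \<Rightarrow> 'a \<Rightarrow> 'a" (infixr "*\<^sub>C" 75)
  assumes scaleC_add_right: "c *\<^sub>C (x + y) = c *\<^sub>C x + c *\<^sub>C y"
    and scaleC_add_left: "(c + d) *\<^sub>C x = c *\<^sub>C x + d *\<^sub>C x"
    and scaleC_scaleC: "c *\<^sub>C (d *\<^sub>C x) = (c * d) *\<^sub>C x"
    and scaleC_one: "1 *\<^sub>C x = x"
    and scaleR_scaleC: "r *\<^sub>R x = complex_of_real r *\<^sub>C x"

text \<open>Unital C*-algebras, normalised by \<open>norm 1 = 1\<close> as in \<^class>\<open>real_normed_algebra_1\<close>;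
  this excludes only the zero algebra.\<close>

class unital_cstar_algebra = complex_vector + real_normed_algebra_1 + banach +
  fixes star :: "'a \<Rightarrow> 'a"
  assumes mult_scaleC_left: "(c *\<^sub>C a) * b = c *\<^sub>C (a * b)"
    and mult_scaleC_right: "a * (c *\<^sub>C b) = c *\<^sub>C (a * b)"
    and norm_scaleC: "norm (c *\<^sub>C a) = cmod c * norm a"
    and star_star: "star (star a) = a"
    and star_add: "star (a + b) = star a + star b"
    and star_scaleC: "star (c *\<^sub>C a) = cnj c *\<^sub>C star a"
    and star_mult: "star (a * b) = star b * star a"
    and cstar_identity: "norm (star a * a) = (norm a)\<^sup>2"

definition cstar_spectrum :: "'a::unital_cstar_algebra \<Rightarrow> complex set" where
  "cstar_spectrum a =
    {c. \<not> (\<exists>b. b * (a - c *\<^sub>C 1) = 1 \<and> (a - c *\<^sub>C 1) * b = 1)}"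

definition cstar_positive :: "'a::unital_cstar_algebra \<Rightarrow> bool" where
  "cstar_positive a \<longleftrightarrow>
    star a = a \<and> (\<forall>c\<in>cstar_spectrum a. \<exists>r\<ge>0. c = complex_of_real r)"

definition cstar_le :: "'a::unital_cstar_algebra \<Rightarrow> 'a \<Rightarrow> bool" where
  "cstar_le a b \<longleftrightarrow> cstar_positive (b - a)"

text \<open>The norm of a Hilbert module is the one of its \<^class>\<open>banach\<close> type; the axiom
  \<open>norm_ip\<close> forces it to be the norm induced by the inner product. That the induced norm
  satisfies the triangle inequality, which the class includes, is the Cauchy-Schwarz inequality
  for Hilbert modules and hence no additional restriction.\<close>

locale hilbert_module =
  fixes act :: "'m::{complex_vector, banach} \<Rightarrow> 'a::unital_cstar_algebra \<Rightarrow> 'm"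
    and ip :: "'m \<Rightarrow> 'm \<Rightarrow> 'a"
  assumes act_add_left: "act (x + y) a = act x a + act y a"
    and act_add_right: "act x (a + b) = act x a + act x b"
    and act_mult: "act x (a * b) = act (act x a) b"
    and act_one: "act x 1 = x"
    and act_scaleC_left: "act (c *\<^sub>C x) a = c *\<^sub>C act x a"
    and act_scaleC_right: "act x (c *\<^sub>C a) = c *\<^sub>C act x a"
    and ip_add_right: "ip x (y + z) = ip x y + ip x z"
    and ip_scaleC_right: "ip x (c *\<^sub>C y) = c *\<^sub>C ip x y"
    and ip_act_right: "ip x (act y a) = ip x y * a"
    and ip_star: "star (ip x y) = ip y x"
    and ip_positive: "cstar_positive (ip x x)"
    and ip_definite: "ip x x = 0 \<Longrightarrow> x = 0"
    and norm_ip: "norm x = sqrt (norm (ip x x))"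

definition orthogonal_system ::
    "('m \<Rightarrow> 'm \<Rightarrow> 'a::unital_cstar_algebra) \<Rightarrow> 'i set \<Rightarrow> ('i \<Rightarrow> 'm) \<Rightarrow> bool" where
  "orthogonal_system ip I e \<longleftrightarrow> (\<forall>i\<in>I. \<forall>j\<in>I. i \<noteq> j \<longrightarrow> ip (e i) (e j) = 0)"

definition orthonormal_system ::
    "('m \<Rightarrow> 'm \<Rightarrow> 'a::unital_cstar_algebra) \<Rightarrow> 'i set \<Rightarrow> ('i \<Rightarrow> 'm) \<Rightarrow> bool" where
  "orthonormal_system ip I e \<longleftrightarrow>
    orthogonal_system ip I e \<and> (\<forall>i\<in>I. ip (e i) (e i) = 1)"

definition module_span ::
    "('m::{complex_vector, banach} \<Rightarrow> 'a::unital_cstar_algebra \<Rightarrow> 'm)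
      \<Rightarrow> 'i set \<Rightarrow> ('i \<Rightarrow> 'm) \<Rightarrow> 'm set" where
  "module_span act I e = {\<Sum>i\<in>F. act (e i) (a i) | F a. finite F \<and> F \<subseteq> I}"

definition cond_c1 ::
    "('m::{complex_vector, banach} \<Rightarrow> 'a::unital_cstar_algebra \<Rightarrow> 'm)
      \<Rightarrow> 'i set \<Rightarrow> ('i \<Rightarrow> 'm) \<Rightarrow> bool" where
  "cond_c1 act I e \<longleftrightarrow> closure (module_span act I e) = UNIV"

definition cond_c2 ::
    "('m::{complex_vector, banach} \<Rightarrow> 'a::unital_cstar_algebra \<Rightarrow> 'm)
      \<Rightarrow> 'i set \<Rightarrow> ('i \<Rightarrow> 'm) \<Rightarrow> bool" where
  "cond_c2 act I e \<longleftrightarrow> (\<forall>x. \<exists>a. ((\<lambda>i. act (e i) (a i)) has_sum x) I)"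

definition cond_c3 ::
    "('m \<Rightarrow> 'm \<Rightarrow> 'a::unital_cstar_algebra) \<Rightarrow> 'i set \<Rightarrow> ('i \<Rightarrow> 'm) \<Rightarrow> bool" where
  "cond_c3 ip I e \<longleftrightarrow>
    (\<forall>x. ((\<lambda>i. 2 * (ip x (e i) * ip (e i) x) - ip x (e i) * ip (e i) (e i) * ip (e i) x)
            has_sum ip x x) I)"

text \<open>Only the coefficients with index in \<open>I\<close> are compared, since \<open>a\<close> is a total function.\<close>

definition schauder_basis ::
    "('m::{complex_vector, banach} \<Rightarrow> 'a::unital_cstar_algebra \<Rightarrow> 'm)
      \<Rightarrow> ('m \<Rightarrow> 'm \<Rightarrow> 'a) \<Rightarrow> 'i set \<Rightarrow> ('i \<Rightarrow> 'm) \<Rightarrow> bool" where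
  "schauder_basis act ip I e \<longleftrightarrow>
    orthogonal_system ip I e \<and>
    (\<forall>x. \<exists>a. ((\<lambda>i. act (e i) (a i)) has_sum x) I \<and>
          (\<forall>b. ((\<lambda>i. act (e i) (b i)) has_sum x) I \<longrightarrow> (\<forall>i\<in>I. b i = a i)))"

definition module_frame ::
    "('m \<Rightarrow> 'm \<Rightarrow> 'a::unital_cstar_algebra) \<Rightarrow> 'i set \<Rightarrow> ('i \<Rightarrow> 'm) \<Rightarrow> bool" where
  "module_frame ip I f \<longleftrightarrow>
    (\<exists>C>0. \<exists>D>0. \<forall>x. \<exists>s. ((\<lambda>i. ip x (f i) * ip (f i) x) has_sum s) I \<and>
        cstar_le (C *\<^sub>R ip x x) s \<and> cstar_le s (D *\<^sub>R ip x x))"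

definition standard_frame ::
    "('m \<Rightarrow> 'm \<Rightarrow> 'a::unital_cstar_algebra) \<Rightarrow> 'i set \<Rightarrow> ('i \<Rightarrow> 'm) \<Rightarrow> bool" where
  "standard_frame ip I f \<longleftrightarrow>
    module_frame ip I f \<and>
    (\<forall>x. ((\<lambda>i. ip x (f i) * ip (f i) x) has_sum ip x x) I)"

text \<open>The linear combinations are over arbitrary, possibly infinite, subsets \<open>S\<close> of \<open>I\<close>;
  for infinite \<open>S\<close> being equal to zero means converging in norm to zero.\<close>

definition standard_riesz_basis ::
    "('m::{complex_vector, banach} \<Rightarrow> 'a::unital_cstar_algebra \<Rightarrow> 'm)
      \<Rightarrow> ('m \<Rightarrow> 'm \<Rightarrow> 'a) \<Rightarrow> 'i set \<Rightarrow> ('i \<Rightarrow> 'm) \<Rightarrow> bool" where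
  "standard_riesz_basis act ip I e \<longleftrightarrow>
    orthogonal_system ip I e \<and> standard_frame ip I e \<and> cond_c1 act I e \<and>
    (\<forall>S a. S \<subseteq> I \<longrightarrow>
      (((\<lambda>j. act (e j) (a j)) has_sum 0) S \<longleftrightarrow> (\<forall>j\<in>S. act (e j) (a j) = 0)))"

end

theory Submission
  imports Defs
begin

text \<open>
  For an orthonormal system the coefficients of an expansion are forced: pairing
  \<open>x = (\<Sum>i\<in>I. e\<^sub>i a\<^sub>i)\<close> with \<open>e\<^sub>j\<close> gives \<open>a\<^sub>j = \<langle>e\<^sub>j, x\<rangle>\<close>, because the inner product is continuous.
  Hence every condition of the theorem can be compared with the single statement that each \<open>x\<close> is
  the sum of its Fourier series \<open>\<Sum>i\<in>I. e\<^sub>i \<langle>e\<^sub>i, x\<rangle>\<close>. Pairing that expansion with \<open>x\<close>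
  gives Parseval's identity. Conversely, convergence of the Fourier series is recovered from Parseval's
  identity since \<open>\<parallel>x - P\<^sub>F x\<parallel>\<^sup>2 = \<parallel>\<langle>x, x\<rangle> - (\<Sum>i\<in>F. \<langle>x, e\<^sub>i\<rangle>\<langle>e\<^sub>i, x\<rangle>)\<parallel>\<close>, where \<open>P\<^sub>F x\<close> denotes the finite
  partial sum over \<open>F\<close>.

  The step with analytic content is from density of the span to convergence of the Fourier series
  (\<open>dense_span_fourier_series\<close>). It uses that \<open>P\<^sub>F x\<close> is, up to a constant factor, a best
  approximation of \<open>x\<close> from the span of \<open>{e\<^sub>i | i \<in> F}\<close>: the residual \<open>z = x - P\<^sub>F x\<close> satisfies
  \<open>\<langle>z, z\<rangle> = \<langle>z, x - v\<rangle>\<close> for every \<open>v\<close> in that span, so a Cauchy--Schwarz inequality bounds \<open>\<parallel>z\<parallel>\<close> by a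
  multiple of \<open>\<parallel>x - v\<parallel>\<close>. Any constant suffices for convergence; with constant \<open>4\<close> the
  inequality follows from polarization and the triangle inequality of the module norm.
\<close>

lemma cstar_le_refl:
  fixes a :: "'a::unital_cstar_algebra"
  shows "cstar_le a a"
proof -
  have "star (0::'a) = 0"
    using star_add[of "0::'a" 0] by simp
  moreover have "c = 0" if "c \<in> cstar_spectrum (0::'a)" for c
  proof (rule ccontr)
    assume "c \<noteq> 0"
    let ?b = "(- 1 / c) *\<^sub>C (1::'a)"
    have "(- c) *\<^sub>C (1::'a) + c *\<^sub>C 1 = 0"
      using scaleC_add_left[of "- c" c "1::'a"] scaleR_scaleC[of 0 "1::'a"] by simp
    hence neg: "0 - c *\<^sub>C (1::'a) = (- c) *\<^sub>C 1"
      unfolding diff_0 by (metis eq_neg_iff_add_eq_0)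
    have "?b * (0 - c *\<^sub>C 1) = 1" "(0 - c *\<^sub>C 1) * ?b = 1"
      unfolding neg mult_scaleC_left mult_scaleC_right scaleC_scaleC mult_1_right
      using \<open>c \<noteq> 0\<close> by (simp_all add: scaleC_one)
    thus False using that by (auto simp: cstar_spectrum_def)
  qed
  hence "\<exists>r\<ge>0. c = complex_of_real r" if "c \<in> cstar_spectrum (0::'a)" for c
    using that by (intro exI[of _ 0]) simp
  ultimately show ?thesis
    unfolding cstar_le_def cstar_positive_def diff_self by blast
qed

section \<open>Continuity of the inner product\<close>

context hilbert_module
begin

lemma ip_add_left: "ip (x + y) z = ip x z + ip y z"
  by (metis ip_add_right ip_star star_add)

lemma ip_scaleC_left: "ip (c *\<^sub>C x) y = cnj c *\<^sub>C ip x y"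
  by (metis ip_scaleC_right ip_star star_scaleC)

lemma ip_scaleR_right: "ip x (r *\<^sub>R y) = r *\<^sub>R ip x y"
  by (simp add: scaleR_scaleC ip_scaleC_right)

lemma ip_scaleR_left: "ip (r *\<^sub>R x) y = r *\<^sub>R ip x y"
  by (simp add: scaleR_scaleC ip_scaleC_left)

lemma ip_act_left: "ip (act x a) y = star a * ip x y"
  by (metis ip_act_right ip_star star_mult)

lemma additive_ip_right: "Modules.additive (ip x)"
  by unfold_locales (rule ip_add_right)

lemma additive_ip_left: "Modules.additive (\<lambda>x. ip x y)"
  by unfold_locales (rule ip_add_left)

lemma additive_act: "Modules.additive (act x)"
  by unfold_locales (rule act_add_right)

lemmas ip_diff_right = Modules.additive.diff[OF additive_ip_right]
lemmas ip_diff_left = Modules.additive.diff[OF additive_ip_left]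
lemmas ip_zero_right = Modules.additive.zero[OF additive_ip_right]
lemmas ip_zero_left = Modules.additive.zero[OF additive_ip_left]
lemmas ip_sum_right = Modules.additive.sum[OF additive_ip_right]
lemmas ip_sum_left = Modules.additive.sum[OF additive_ip_left]
lemmas act_zero_right = Modules.additive.zero[OF additive_act]

lemma norm_ip_self: "norm (ip x x) = (norm x)\<^sup>2"
  by (simp add: norm_ip)

text \<open>The first half of the polarization identity,
  \<open>2 (\<langle>x, y\<rangle> + \<langle>y, x\<rangle>) = \<langle>x + y, x + y\<rangle> - \<langle>x - y, x - y\<rangle>\<close>, turned into an estimate.\<close>

lemma norm_ip_symmetric_part:
  "norm (ip x y + ip y x) \<le> (norm x + norm y)\<^sup>2"
proof -
  have "2 *\<^sub>R (ip x y + ip y x) = ip (x + y) (x + y) - ip (x - y) (x - y)"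
    by (simp add: ip_add_left ip_add_right ip_diff_left ip_diff_right scaleR_2)
  hence "2 * norm (ip x y + ip y x) = norm (ip (x + y) (x + y) - ip (x - y) (x - y))"
    by (metis norm_scaleR abs_numeral)
  also have "\<dots> \<le> (norm (x + y))\<^sup>2 + (norm (x - y))\<^sup>2"
    by (metis norm_triangle_ineq4 norm_ip_self)
  also have "\<dots> \<le> (norm x + norm y)\<^sup>2 + (norm x + norm y)\<^sup>2"
    by (intro add_mono power_mono norm_triangle_ineq norm_triangle_ineq4 norm_ge_zero)
  finally show ?thesis by simp
qed

text \<open>Replacing \<open>y\<close> by \<open>\<i> y\<close> turns the symmetric part of the inner product into the
  antisymmetric one, so both parts obey the same estimate.\<close>

lemma norm_ip_le_square:
  "norm (ip x y) \<le> (norm x + norm y)\<^sup>2"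
proof -
  have "norm (\<i> *\<^sub>C y) = norm y"
    by (simp add: norm_ip ip_scaleC_left ip_scaleC_right norm_scaleC)
  moreover have "ip x (\<i> *\<^sub>C y) + ip (\<i> *\<^sub>C y) x = \<i> *\<^sub>C (ip x y - ip y x)"
  proof -
    have "\<i> *\<^sub>C (ip x y - ip y x) + (\<i> *\<^sub>C ip y x + (- \<i>) *\<^sub>C ip y x)
        = \<i> *\<^sub>C ip x y + (- \<i>) *\<^sub>C ip y x"
      by (metis scaleC_add_right add.assoc diff_add_cancel)
    moreover have "\<i> *\<^sub>C ip y x + (- \<i>) *\<^sub>C ip y x = (0::'a)"
      using scaleC_add_left[of "\<i>" "- \<i>" "ip y x"] scaleR_scaleC[of 0 "ip y x"] by simp
    ultimately show ?thesis by (simp add: ip_scaleC_left ip_scaleC_right)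
  qed
  ultimately have "norm (ip x y - ip y x) \<le> (norm x + norm y)\<^sup>2"
    using norm_ip_symmetric_part[of x "\<i> *\<^sub>C y"] by (simp add: norm_scaleC)
  moreover have "norm (2 *\<^sub>R ip x y) \<le> norm (ip x y + ip y x) + norm (ip x y - ip y x)"
    using norm_triangle_ineq[of "ip x y + ip y x" "ip x y - ip y x"] by (simp add: scaleR_2)
  ultimately show ?thesis using norm_ip_symmetric_part[of x y] by simp
qed

text \<open>A weak Cauchy--Schwarz inequality: on unit vectors the preceding estimate gives the
  constant \<open>(1 + 1)\<^sup>2 = 4\<close>, and the general case follows by rescaling.\<close>

lemma norm_ip_le: "norm (ip x y) \<le> 4 * norm x * norm y"
proof (cases "x = 0 \<or> y = 0")
  case True
  thus ?thesis by (auto simp: ip_zero_left ip_zero_right)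
next
  case False
  have "norm (ip (x /\<^sub>R norm x) (y /\<^sub>R norm y)) \<le> 4"
    using norm_ip_le_square[of "x /\<^sub>R norm x" "y /\<^sub>R norm y"] False by simp
  thus ?thesis using False
    by (simp add: ip_scaleR_left ip_scaleR_right field_simps)
qed

lemma bounded_linear_ip_right: "bounded_linear (ip x)"
  by (rule bounded_linear_intro[where K = "4 * norm x"])
     (use norm_ip_le[of x] in \<open>simp_all add: ip_add_right ip_scaleR_right mult.commute\<close>)

section \<open>Fourier coefficients and partial sums\<close>

definition fourier_partial_sum :: "('i \<Rightarrow> 'm) \<Rightarrow> 'i set \<Rightarrow> 'm \<Rightarrow> 'm" where
  "fourier_partial_sum e F x = (\<Sum>i\<in>F. act (e i) (ip (e i) x))"

lemma orthonormal_ip: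
  assumes "orthonormal_system ip I e" "i \<in> I" "j \<in> I"
  shows "ip (e i) (e j) = (if i = j then 1 else 0)"
  using assms by (auto simp: orthonormal_system_def orthogonal_system_def)

lemma ip_orthonormal_combination:
  assumes "orthonormal_system ip I e" "finite F" "F \<subseteq> I" "j \<in> F"
  shows "ip (e j) (\<Sum>i\<in>F. act (e i) (b i)) = b j"
proof -
  have "ip (e j) (\<Sum>i\<in>F. act (e i) (b i)) = (\<Sum>i\<in>F. if i = j then b i else 0)"
    unfolding ip_sum_right
    by (rule sum.cong) (use assms in \<open>auto simp: ip_act_right orthonormal_ip[OF assms(1)] subset_iff\<close>)
  thus ?thesis using assms by simp
qed

text \<open>Continuity of the inner product lets it be applied termwise to a convergent expansion, where
  orthonormality leaves a single term. Stating this for sums over subsets \<open>S\<close> of the index set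
  covers the independence clause of standard Riesz bases, with \<open>x = 0\<close>.\<close>

lemma expansion_coefficient:
  assumes on: "orthonormal_system ip I e" and S: "S \<subseteq> I" and j: "j \<in> S"
    and sum: "((\<lambda>i. act (e i) (b i)) has_sum x) S"
  shows "b j = ip (e j) x"
proof -
  have 1: "((\<lambda>i. ip (e j) (act (e i) (b i))) has_sum ip (e j) x) S"
    by (rule has_sum_bounded_linear[OF bounded_linear_ip_right sum, unfolded o_def])
  have "((\<lambda>i. ip (e j) (act (e i) (b i))) has_sum b j) S"
  proof (rule has_sum_finite_neutralI[where B = "{j}"])
    show "b j = (\<Sum>i\<in>{j}. ip (e j) (act (e i) (b i)))"
      using j S by (auto simp: ip_act_right orthonormal_ip[OF on])
    show "ip (e j) (act (e i) (b i)) = 0" if "i \<in> S - {j}" for i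
      using that j S by (auto simp: ip_act_right orthonormal_ip[OF on] subset_iff)
  qed (use j in auto)
  thus ?thesis using 1 has_sum_unique by blast
qed

lemma ip_fourier_residual:
  assumes "orthonormal_system ip I e" "finite F" "F \<subseteq> I"
  shows "ip (x - fourier_partial_sum e F x) (\<Sum>i\<in>F. act (e i) (b i)) = 0"
proof -
  have "ip (e j) (x - fourier_partial_sum e F x) = 0" if "j \<in> F" for j
    using ip_orthonormal_combination[OF assms that]
    by (simp add: ip_diff_right fourier_partial_sum_def)
  hence "ip (x - fourier_partial_sum e F x) (e j) = 0" if "j \<in> F" for j
    using that by (metis ip_star ip_zero_left ip_zero_right)
  thus ?thesis by (simp add: ip_sum_right ip_act_right)
qed

text \<open>The quasi-optimality of Fourier partial sums: as the residual is orthogonal to the span, its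
  square is also its inner product with \<open>x - v\<close> for any competitor \<open>v\<close>.\<close>

lemma norm_fourier_residual_le:
  assumes "orthonormal_system ip I e" "finite F" "F \<subseteq> I"
  shows "norm (x - fourier_partial_sum e F x) \<le> 4 * norm (x - (\<Sum>i\<in>F. act (e i) (b i)))"
proof -
  define z w where "z = x - fourier_partial_sum e F x" and "w = x - (\<Sum>i\<in>F. act (e i) (b i))"
  have "ip z z = ip z x" "ip z w = ip z x"
    using ip_fourier_residual[OF assms, of x b]
      ip_fourier_residual[OF assms, of x "\<lambda>i. ip (e i) x"]
    by (simp_all add: z_def w_def ip_diff_right fourier_partial_sum_def)
  hence "(norm z)\<^sup>2 \<le> 4 * norm z * norm w"
    using norm_ip_le[of z w] norm_ip_self[of z] by simp
  hence "norm z \<le> 4 * norm w"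
    by (cases "z = 0") (auto simp: power2_eq_square)
  thus ?thesis by (simp add: z_def w_def)
qed

lemma norm_fourier_residual_eq:
  assumes "orthonormal_system ip I e" "finite F" "F \<subseteq> I"
  shows "norm (x - fourier_partial_sum e F x) =
    sqrt (norm (ip x x - (\<Sum>i\<in>F. ip x (e i) * ip (e i) x)))"
proof -
  let ?z = "x - fourier_partial_sum e F x"
  have "ip ?z ?z = ip ?z x"
    using ip_fourier_residual[OF assms, of x "\<lambda>i. ip (e i) x"]
    by (simp add: ip_diff_right fourier_partial_sum_def)
  also have "\<dots> = ip x x - (\<Sum>i\<in>F. ip x (e i) * ip (e i) x)"
    by (simp add: ip_diff_left fourier_partial_sum_def ip_sum_left ip_act_left ip_star)
  finally show ?thesis by (simp add: norm_ip)
qed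

section \<open>Fourier expansion, dense span and Parseval's identity\<close>

definition fourier_expansion :: "'i set \<Rightarrow> ('i \<Rightarrow> 'm) \<Rightarrow> bool" where
  "fourier_expansion I e \<longleftrightarrow> (\<forall>x. ((\<lambda>i. act (e i) (ip (e i) x)) has_sum x) I)"

definition parseval :: "'i set \<Rightarrow> ('i \<Rightarrow> 'm) \<Rightarrow> bool" where
  "parseval I e \<longleftrightarrow> (\<forall>x. ((\<lambda>i. ip x (e i) * ip (e i) x) has_sum ip x x) I)"

text \<open>A combination over \<open>F\<^sub>0\<close> that is close to \<open>x\<close> is a competitor for every \<open>F \<supseteq> F\<^sub>0\<close>, its
  coefficients being extended by zero; so all later partial sums are close to \<open>x\<close> as well.\<close>

lemma dense_span_fourier_series:
  assumes on: "orthonormal_system ip I e" and dense: "cond_c1 act I e"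
  shows "fourier_expansion I e"
  unfolding fourier_expansion_def has_sum_def tendsto_iff eventually_finite_subsets_at_top
proof (intro allI impI)
  fix x and \<epsilon> :: real
  assume "\<epsilon> > 0"
  have "x \<in> closure (module_span act I e)"
    using dense by (simp add: cond_c1_def)
  then obtain v where v: "v \<in> module_span act I e" "dist v x < \<epsilon> / 4"
    using \<open>\<epsilon> > 0\<close> closure_approachable by (metis divide_pos_pos zero_less_numeral)
  then obtain F0 b where F0: "finite F0" "F0 \<subseteq> I" and v_eq: "v = (\<Sum>i\<in>F0. act (e i) (b i))"
    by (auto simp: module_span_def)
  have "dist (\<Sum>i\<in>F. act (e i) (ip (e i) x)) x < \<epsilon>" if F: "finite F" "F0 \<subseteq> F" "F \<subseteq> I" for F
  proof -
    define b' where "b' i = (if i \<in> F0 then b i else 0)" for i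
    have "(\<Sum>i\<in>F. act (e i) (b' i)) = v"
      unfolding v_eq
      by (rule sum.mono_neutral_cong_right) (use F in \<open>auto simp: b'_def act_zero_right\<close>)
    hence "norm (x - fourier_partial_sum e F x) \<le> 4 * norm (x - v)"
      using norm_fourier_residual_le[OF on F(1,3), of x b'] by simp
    thus ?thesis
      using v(2) by (simp add: dist_norm norm_minus_commute fourier_partial_sum_def)
  qed
  thus "\<exists>X. finite X \<and> X \<subseteq> I \<and>
      (\<forall>Y. finite Y \<and> X \<subseteq> Y \<and> Y \<subseteq> I \<longrightarrow> dist (\<Sum>i\<in>Y. act (e i) (ip (e i) x)) x < \<epsilon>)"
    using F0 by blast
qed

lemma expansion_imp_dense_span:
  assumes "cond_c2 act I e"
  shows "cond_c1 act I e"
proof -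
  have "x \<in> closure (module_span act I e)" for x
  proof -
    obtain a where "((\<lambda>i. act (e i) (a i)) has_sum x) I"
      using assms by (auto simp: cond_c2_def)
    hence lim: "(sum (\<lambda>i. act (e i) (a i)) \<longlongrightarrow> x) (finite_subsets_at_top I)"
      by (simp add: has_sum_def)
    show ?thesis
    proof (rule Lim_in_closed_set[OF closed_closure _ _ lim])
      show "\<forall>\<^sub>F F in finite_subsets_at_top I.
          (\<Sum>i\<in>F. act (e i) (a i)) \<in> closure (module_span act I e)"
        by (intro eventually_finite_subsets_at_top_weakI closure_subset[THEN subsetD])
          (auto simp: module_span_def)
    qed simp
  qed
  thus ?thesis by (auto simp: cond_c1_def)
qed

lemma fourier_expansion_iff_parseval:
  assumes on: "orthonormal_system ip I e"
  shows "fourier_expansion I e \<longleftrightarrow> parseval I e"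
proof
  assume F: "fourier_expansion I e"
  show "parseval I e"
    unfolding parseval_def
  proof
    fix x
    have "((\<lambda>i. act (e i) (ip (e i) x)) has_sum x) I"
      using F by (simp add: fourier_expansion_def)
    from has_sum_bounded_linear[OF bounded_linear_ip_right[of x] this]
    show "((\<lambda>i. ip x (e i) * ip (e i) x) has_sum ip x x) I"
      by (simp add: o_def ip_act_right)
  qed
next
  assume P: "parseval I e"
  show "fourier_expansion I e"
    unfolding fourier_expansion_def
  proof
    fix x
    let ?p = "\<lambda>F. \<Sum>i\<in>F. ip x (e i) * ip (e i) x"
    have "(?p \<longlongrightarrow> ip x x) (finite_subsets_at_top I)"
      using P by (simp add: parseval_def has_sum_def)
    hence "((\<lambda>F. sqrt (norm (ip x x - ?p F))) \<longlongrightarrow> sqrt (norm (ip x x - ip x x)))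
        (finite_subsets_at_top I)"
      by (intro tendsto_intros)
    moreover have "\<forall>\<^sub>F F in finite_subsets_at_top I.
        sqrt (norm (ip x x - ?p F)) = norm (x - fourier_partial_sum e F x)"
      by (intro eventually_finite_subsets_at_top_weakI) (simp add: norm_fourier_residual_eq[OF on])
    ultimately have "((\<lambda>F. norm (fourier_partial_sum e F x - x)) \<longlongrightarrow> 0) (finite_subsets_at_top I)"
      by (simp add: norm_minus_commute tendsto_cong)
    thus "((\<lambda>i. act (e i) (ip (e i) x)) has_sum x) I"
      by (simp add: has_sum_def fourier_partial_sum_def tendsto_norm_zero_iff LIM_zero_iff)
  qed
qed

lemma cond_c3_iff_parseval:
  assumes "orthonormal_system ip I e"
  shows "cond_c3 ip I e \<longleftrightarrow> parseval I e"
proof -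
  have "((\<lambda>i. 2 * (ip x (e i) * ip (e i) x) - ip x (e i) * ip (e i) (e i) * ip (e i) x)
      has_sum s) I \<longleftrightarrow> ((\<lambda>i. ip x (e i) * ip (e i) x) has_sum s) I" for x s
    by (rule has_sum_cong) (simp add: orthonormal_ip[OF assms] mult_2)
  thus ?thesis by (simp add: cond_c3_def parseval_def)
qed

text \<open>Under Parseval's identity both frame inequalities are equalities, with \<open>C = D = 1\<close>.\<close>

lemma standard_frame_iff_parseval: "standard_frame ip I e \<longleftrightarrow> parseval I e"
proof -
  have "module_frame ip I e" if "parseval I e"
    unfolding module_frame_def
  proof (intro exI[of _ "1::real"] conjI allI)
    fix x
    show "\<exists>s. ((\<lambda>i. ip x (e i) * ip (e i) x) has_sum s) I \<and>
        cstar_le (1 *\<^sub>R ip x x) s \<and> cstar_le s (1 *\<^sub>R ip x x)"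
      using that cstar_le_refl by (intro exI[of _ "ip x x"]) (simp add: parseval_def)
  qed simp_all
  thus ?thesis by (auto simp: standard_frame_def parseval_def)
qed

lemma cond_c2_iff_schauder_basis:
  assumes on: "orthonormal_system ip I e"
  shows "cond_c2 act I e \<longleftrightarrow> schauder_basis act ip I e"
proof
  assume c2: "cond_c2 act I e"
  have "b i = a i" if "((\<lambda>i. act (e i) (a i)) has_sum x) I"
    "((\<lambda>i. act (e i) (b i)) has_sum x) I" "i \<in> I" for a b x i
    using expansion_coefficient[OF on subset_refl that(3)] that(1,2) by metis
  thus "schauder_basis act ip I e"
    using c2 on unfolding schauder_basis_def cond_c2_def orthonormal_system_def by metis
next
  assume "schauder_basis act ip I e"
  thus "cond_c2 act I e"
    unfolding schauder_basis_def cond_c2_def by blast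
qed

lemma orthonormal_sum_zero_iff:
  assumes on: "orthonormal_system ip I e" and S: "S \<subseteq> I"
  shows "((\<lambda>j. act (e j) (a j)) has_sum 0) S \<longleftrightarrow> (\<forall>j\<in>S. act (e j) (a j) = 0)"
proof
  assume "((\<lambda>j. act (e j) (a j)) has_sum 0) S"
  hence "a j = 0" if "j \<in> S" for j
    using expansion_coefficient[OF on S that, of a 0] by (simp add: ip_zero_right)
  thus "\<forall>j\<in>S. act (e j) (a j) = 0" by (simp add: act_zero_right)
next
  assume "\<forall>j\<in>S. act (e j) (a j) = 0"
  thus "((\<lambda>j. act (e j) (a j)) has_sum 0) S" by (intro has_sum_0) simp
qed

end

section \<open>Equivalence of the conditions\<close>

theorem corollary2p11:
  fixes act :: "'m::{complex_vector, banach} \<Rightarrow> 'a::unital_cstar_algebra \<Rightarrow> 'm"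
    and ip :: "'m \<Rightarrow> 'm \<Rightarrow> 'a"
    and I :: "'i set"
    and e :: "'i \<Rightarrow> 'm"
  assumes "hilbert_module act ip"
    and "orthonormal_system ip I e"
  shows "(schauder_basis act ip I e \<longleftrightarrow> standard_riesz_basis act ip I e) \<and>
    (standard_riesz_basis act ip I e \<longleftrightarrow> cond_c1 act I e) \<and>
    (standard_riesz_basis act ip I e \<longleftrightarrow> cond_c2 act I e) \<and>
    (standard_riesz_basis act ip I e \<longleftrightarrow> cond_c3 ip I e)"
proof -
  interpret hilbert_module act ip by fact
  note on = assms(2)
  have "cond_c2 act I e" if "fourier_expansion I e"
    using that by (auto simp: fourier_expansion_def cond_c2_def)
  hence c1: "cond_c1 act I e \<longleftrightarrow> fourier_expansion I e"
    and c2: "cond_c2 act I e \<longleftrightarrow> fourier_expansion I e"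
    using dense_span_fourier_series[OF on] expansion_imp_dense_span by blast+
  have c3: "cond_c3 ip I e \<longleftrightarrow> fourier_expansion I e"
    using cond_c3_iff_parseval[OF on] fourier_expansion_iff_parseval[OF on] by simp
  have riesz: "standard_riesz_basis act ip I e \<longleftrightarrow> fourier_expansion I e"
    using c1 on standard_frame_iff_parseval fourier_expansion_iff_parseval[OF on]
      orthonormal_sum_zero_iff[OF on]
    by (auto simp: standard_riesz_basis_def orthonormal_system_def)
  show ?thesis
    using c1 c2 c3 riesz cond_c2_iff_schauder_basis[OF on] by simp
qed

end
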